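(* Let $\mathbf{X},\mathbf{Y},\mathbf{Z}$ be finite nonempty sets, and let $N\ge1$ be an integer. Let $q$ be a probability measure on $\mathbf{Z}$ with $q(z)>0$ for all $z\in\mathbf{Z}$, and for each $(x',z)\in\mathbf{X}\times\mathbf{Z}$ let $r(\cdot\mid x',z)$ be a probability measure on $\mathbf{Y}$ with $r(y\mid x',z)>0$ for all $y\in\mathbf{Y}$. For each $n\in[N]$ let $k_n(\cdot\mid x_1,\dots,x_{n-1},z_1,\dots,z_n)$ be an arbitrary probability measure on $\mathbf{X}$ for each $(x_1,\dots,x_{n-1})\in\mathbf{X}^{n-1}$ and $(z_1,\dots,z_n)\in\mathbf{Z}^n$. Let the random variables $(X_n,Y_n,Z_n)$, $n\in[N]$, have joint distribution $$\mathbb{P}\bigl((X_n,Y_n,Z_n)=(x_n,y_n,z_n)\ \text{for all } n\in[N]\bigr)=\prod_{n=1}^N q(z_n)\,k_n(x_n\mid x_1,\dots,x_{n-1},z_1,\dots,z_n)\,r(y_n\mid x_n,z_n).$$ Fix $x\in\mathbf{X}$, and for $y\in\mathbf{Y}$ let $$p_y:=\sum_{z\in\mathbf{Z}}q(z)\,r(y\mid x,z)$$ and $$F_y:=\sum_{z\in\mathbf{Z}}\frac{|\{n\in[N]:Z_n=z\}|+1}{N+1}\times\frac{|\{n\in[N]:(X_n,Y_n,Z_n)=(x,y,z)\}|+1}{|\{n\in[N]:(X_n,Z_n)=(x,z)\}|+1}.$$ Then for each $y\in\mathbf{Y}$, $$\mathbb{E}\,\frac{p_y}{F_y}\le 1.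$$
   Context: For a positive integer $N$, $[N]:=\{1,\dots,N\}$; $|A|$ denotes the cardinality of a finite set $A$. The displayed joint distribution expresses the "$Y$-oblivious interpretation" of the repeated causal graph: each $Z_n$ is generated by a fixed stochastic mechanism $q$ with no incoming arrows, each $X_n$ has incoming arrows from $Z_n$ and from all $X_i,Z_i$ with $i<n$ (but not from any $Y_i$) and is not assumed to be generated by a stable mechanism, and each $Y_n$ has incoming arrows only from $X_n$ and $Z_n$ and is generated by a fixed stochastic mechanism $r$. The expectation is over the random variables $(X_n,Y_n,Z_n)$, $n\in[N]$. *)

theory Defs
  imports "HOL-Probability.Probability"
begin

definition p_do :: "'z::finite pmf \<Rightarrow> ('x \<Rightarrow> 'z \<Rightarrow> 'y pmf) \<Rightarrow> 'x \<Rightarrow> 'y \<Rightarrow> real" where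
  "p_do q r x y = (\<Sum>z\<in>UNIV. pmf q z * pmf (r x z) y)"

text \<open>The arguments \<open>xs\<close>, \<open>ys\<close>, \<open>zs\<close> are the observed sequences; only the entries with
  index in \<open>{1..N}\<close> matter.\<close>

definition F_do ::
  "nat \<Rightarrow> (nat \<Rightarrow> 'x) \<Rightarrow> (nat \<Rightarrow> 'y) \<Rightarrow> (nat \<Rightarrow> 'z::finite) \<Rightarrow> 'x \<Rightarrow> 'y \<Rightarrow> real" where
  "F_do N xs ys zs x y =
     (\<Sum>z\<in>UNIV.
        (real (card {n\<in>{1..N}. zs n = z}) + 1) / (real N + 1) *
        ((real (card {n\<in>{1..N}. (xs n, ys n, zs n) = (x, y, z)}) + 1) /
         (real (card {n\<in>{1..N}. (xs n, zs n) = (x, z)}) + 1)))"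

text \<open>The joint mass function. The kernel at time \<open>n\<close> is \<open>k n [x\<^sub>1, \<dots>, x\<^sub>n\<^sub>-\<^sub>1] [z\<^sub>1, \<dots>, z\<^sub>n]\<close>;
  its values on lists of other lengths are irrelevant.\<close>

definition oblivious_mass ::
  "nat \<Rightarrow> 'z pmf \<Rightarrow> (nat \<Rightarrow> 'x list \<Rightarrow> 'z list \<Rightarrow> 'x pmf) \<Rightarrow> ('x \<Rightarrow> 'z \<Rightarrow> 'y pmf) \<Rightarrow>
   (nat \<Rightarrow> 'x) \<Rightarrow> (nat \<Rightarrow> 'y) \<Rightarrow> (nat \<Rightarrow> 'z) \<Rightarrow> real" where
  "oblivious_mass N q k r xs ys zs =
     (\<Prod>n\<in>{1..N}. pmf q (zs n) * pmf (k n (map xs [1..<n]) (map zs [1..<Suc n])) (xs n) *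
                  pmf (r (xs n) (zs n)) (ys n))"

end

theory Submission
  imports Defs
begin

text \<open>
  Write \<open>F = (\<Sum>z. f z)\<close> for the estimator, where \<open>f z = (A z + 1) / (N + 1) * ((C z + 1) / (B z + 1))\<close>
  and \<open>A z\<close>, \<open>B z\<close>, \<open>C z\<close> count the times at which the observations agree with \<open>z\<close>, with
  \<open>(x, z)\<close>, and with \<open>(x, y, z)\<close>; and write \<open>p = (\<Sum>z. p z)\<close> with \<open>p z = q z * r (y | x, z)\<close>.
  Since \<open>t \<mapsto> 1 / t\<close> is convex, \<open>p / F\<close> is at most the average, with weights \<open>p z / p\<close>, of the
  ratios \<open>p z / f z\<close> (\<open>ratio_of_sums_le\<close>). It therefore suffices that each ratio
  \<open>(N + 1) * q z / (A z + 1) * ((B z + 1) * r (y | x, z) / (C z + 1))\<close>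
  has expectation at most \<open>1\<close>.

  Both factors have the form \<open>(n + 1) p / (S + 1)\<close>, and if \<open>S\<close> is binomial with parameters \<open>n\<close>
  and \<open>p\<close>, the mean of this is \<open>1 - (1 - p) ^ (n + 1)\<close> (\<open>expectation_add_one_binomial\<close>).
  This applies twice, summing out the variables in the order \<open>Y\<close>, \<open>X\<close>, \<open>Z\<close>. The kernels producing
  the \<open>X n\<close> never look at the \<open>Y n\<close>, so given all of \<open>X\<close> and \<open>Z\<close> the \<open>Y n\<close> are still independent,
  and \<open>C z\<close> is binomial with parameters \<open>B z\<close> and \<open>r (y | x, z)\<close>. What remains after bounding
  the second factor no longer depends on \<open>X\<close>, whose conditional masses sum to \<open>1\<close>
  (\<open>sum_prod_adapted_kernels\<close>). Finally the \<open>Z n\<close> are independent with law \<open>q\<close>, so \<open>A z\<close> is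
  binomial with parameters \<open>N\<close> and \<open>q z\<close>.
\<close>

section \<open>Add-one estimates of binomial frequencies\<close>

text \<open>
  By absorption, \<open>(n + 1) / (j + 1) * (n choose j) = (n + 1 choose j + 1)\<close>, so the expectation is
  the binomial expansion of \<open>(p + (1 - p)) ^ (n + 1)\<close> without its \<open>0\<close>-th term.
\<close>

lemma expectation_add_one_binomial:
  fixes p :: real
  assumes p: "p \<in> {0..1}"
  shows "measure_pmf.expectation (binomial_pmf n p) (\<lambda>j. (real n + 1) * p / (real j + 1))
           = 1 - (1 - p) ^ Suc n"
proof -
  have absorb: "real (n choose j) * ((real n + 1) / (real j + 1)) = real (Suc n choose Suc j)" for j
  proof -
    have "(real j + 1) * real (Suc n choose Suc j) = (real n + 1) * real (n choose j)"
      using arg_cong[OF Suc_times_binomial[of j n], of real] by (simp only: of_nat_mult of_nat_Suc)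
        (simp add: algebra_simps)
    then show ?thesis by (simp add: field_simps del: binomial_Suc_Suc)
  qed
  have "measure_pmf.expectation (binomial_pmf n p) (\<lambda>j. (real n + 1) * p / (real j + 1))
      = (\<Sum>j\<le>n. real (n choose j) * p ^ j * (1 - p) ^ (n - j) * ((real n + 1) * p / (real j + 1)))"
    by (simp add: expectation_binomial_pmf'[OF p])
  also have "\<dots> = (\<Sum>j\<le>n. real (Suc n choose Suc j) * p ^ Suc j * (1 - p) ^ (Suc n - Suc j))"
    by (intro sum.cong refl) (simp add: absorb[symmetric] del: binomial_Suc_Suc)
  also have "\<dots> = (\<Sum>j\<le>Suc n. real (Suc n choose j) * p ^ j * (1 - p) ^ (Suc n - j))
                  - (1 - p) ^ Suc n"
    by (subst sum.atMost_Suc_shift) simp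
  also have "(\<Sum>j\<le>Suc n. real (Suc n choose j) * p ^ j * (1 - p) ^ (Suc n - j)) = 1"
    using binomial_ring[of p "1 - p" "Suc n"] by simp
  finally show ?thesis .
qed

text \<open>
  The coordinates need not be identically distributed, and the count may run over a part \<open>S\<close> of
  the index set: only the probability of hitting \<open>a\<close> has to be constant, and only on \<open>S\<close>.
\<close>

lemma count_Pi_pmf_binomial:
  fixes P :: "'i \<Rightarrow> 'a pmf"
  assumes A: "finite A" "S \<subseteq> A" and p: "p \<in> {0..1}" "\<And>n. n \<in> S \<Longrightarrow> pmf (P n) a = p"
  shows "map_pmf (\<lambda>f. card {n\<in>S. f n = a}) (Pi_pmf A d P) = binomial_pmf (card S) p"
proof -
  have S: "finite S" using A finite_subset by blast
  have bernoulli: "map_pmf (\<lambda>b. b = a) (P n) = bernoulli_pmf p" if "n \<in> S" for n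
  proof (rule pmf_eqI)
    fix b
    have "pmf (map_pmf (\<lambda>b. b = a) (P n)) True = p"
      using p(2)[OF that] by (simp add: pmf_map vimage_def pmf.rep_eq)
    then show "pmf (map_pmf (\<lambda>b. b = a) (P n)) b = pmf (bernoulli_pmf p) b"
      using p(1) by (cases b) (simp_all add: pmf_False_conv_True)
  qed
  have "binomial_pmf (card S) p
      = map_pmf (\<lambda>f. card {n\<in>S. f n}) (Pi_pmf S (d = a) (\<lambda>_. bernoulli_pmf p))"
    by (rule binomial_pmf_altdef') (use S p in auto)
  also have "Pi_pmf S (d = a) (\<lambda>_. bernoulli_pmf p)
      = Pi_pmf S (d = a) (\<lambda>n. map_pmf (\<lambda>b. b = a) (P n))"
    by (rule Pi_pmf_cong) (auto simp: bernoulli)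
  also have "\<dots> = map_pmf (\<lambda>h. (\<lambda>b. b = a) \<circ> h) (Pi_pmf S d P)"
    using S by (rule Pi_pmf_map) simp
  also have "Pi_pmf S d P = map_pmf (\<lambda>f n. if n \<in> S then f n else d) (Pi_pmf A d P)"
    by (rule Pi_pmf_subset) (use A in auto)
  also have "map_pmf (\<lambda>f. card {n\<in>S. f n}) (map_pmf (\<lambda>h. (\<lambda>b. b = a) \<circ> h) \<dots>)
      = map_pmf (\<lambda>f. card {n\<in>S. f n = a}) (Pi_pmf A d P)"
    by (auto simp: pmf.map_comp o_def intro!: pmf.map_cong arg_cong[of _ _ card])
  finally show ?thesis by simp
qed

lemma sum_add_one_count_le_1:
  fixes P :: "'i \<Rightarrow> 'a::finite pmf"
  assumes A: "finite A" "S \<subseteq> A" and p: "p \<in> {0..1}" "\<And>n. n \<in> S \<Longrightarrow> pmf (P n) a = p"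
  shows "(\<Sum>f\<in>A \<rightarrow>\<^sub>E UNIV. (\<Prod>n\<in>A. pmf (P n) (f n)) *
            ((real (card S) + 1) * p / (real (card {n\<in>S. f n = a}) + 1))) \<le> 1"
    (is "?L \<le> 1")
proof -
  let ?g = "\<lambda>j. (real (card S) + 1) * p / (real j + 1)"
  have "?L = measure_pmf.expectation (Pi_pmf A undefined P) (\<lambda>f. ?g (card {n\<in>S. f n = a}))"
  proof (subst integral_measure_pmf_real[where A = "A \<rightarrow>\<^sub>E UNIV"])
    show "finite (A \<rightarrow>\<^sub>E (UNIV :: 'a set))" by (rule finite_PiE) (use A in auto)
    show "f \<in> A \<rightarrow>\<^sub>E UNIV" if "f \<in> set_pmf (Pi_pmf A undefined P)" for f
      using that set_Pi_pmf_subset[OF A(1), of undefined P] by (auto simp: PiE_def extensional_def)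
    have "(\<Prod>n\<in>A. pmf (P n) (f n)) = pmf (Pi_pmf A undefined P) f" if "f \<in> A \<rightarrow>\<^sub>E UNIV" for f
      by (rule pmf_Pi'[symmetric]) (use that A in \<open>auto simp: PiE_def extensional_def\<close>)
    then show "?L = (\<Sum>f\<in>A \<rightarrow>\<^sub>E UNIV. ?g (card {n\<in>S. f n = a}) * pmf (Pi_pmf A undefined P) f)"
      by (intro sum.cong refl) simp
  qed
  also have "\<dots> = measure_pmf.expectation (binomial_pmf (card S) p) ?g"
    by (simp add: count_Pi_pmf_binomial[OF A p, where d = undefined, symmetric])
  also have "\<dots> \<le> 1"
    using p(1) by (simp add: expectation_add_one_binomial)
  finally show ?thesis .
qed

section \<open>Total mass of a product of adapted kernels\<close>

text \<open>
  Summing out the last coordinate first: by adaptedness it occurs only in the last factor, which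
  is a probability mass function of it.
\<close>

lemma sum_prod_adapted_kernels:
  fixes K :: "nat \<Rightarrow> (nat \<Rightarrow> 'x::finite) \<Rightarrow> 'x pmf"
  assumes adapted: "\<And>n f g. (\<And>i. i \<in> {1..<n} \<Longrightarrow> f i = g i) \<Longrightarrow> K n f = K n g"
  shows "(\<Sum>f\<in>{1..N} \<rightarrow>\<^sub>E UNIV. \<Prod>n\<in>{1..N}. pmf (K n f) (f n)) = 1"
proof (induction N)
  case 0
  then show ?case by simp
next
  case (Suc N)
  let ?E = "{1..N} \<rightarrow>\<^sub>E (UNIV :: 'x set)"
  let ?m = "\<lambda>N f. \<Prod>n\<in>{1..N}. pmf (K n f) (f n)"
  have upd: "?m (Suc N) (f(Suc N := a)) = ?m N f * pmf (K (Suc N) f) a" for f a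
  proof -
    have "K n (f(Suc N := a)) = K n f" if "n \<le> Suc N" for n
      by (rule adapted) (use that in auto)
    then show ?thesis by simp
  qed
  have "(\<Sum>f\<in>{1..Suc N} \<rightarrow>\<^sub>E UNIV. ?m (Suc N) f)
      = (\<Sum>f\<in>(\<lambda>(a, f). f(Suc N := a)) ` (UNIV \<times> ?E). ?m (Suc N) f)"
    by (simp only: atLeastAtMostSuc_conv[of 1 N] PiE_insert_eq)
  also have "\<dots> = (\<Sum>(a, f)\<in>UNIV \<times> ?E. ?m N f * pmf (K (Suc N) f) a)"
    by (subst sum.reindex[OF inj_combinator])
      (auto simp: upd case_prod_unfold comp_def
        simp del: prod.cl_ivl_Suc fun_upd_apply One_nat_def)
  also have "\<dots> = (\<Sum>f\<in>?E. ?m N f * (\<Sum>a\<in>UNIV. pmf (K (Suc N) f) a))"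
    unfolding sum.cartesian_product[symmetric] by (subst sum.swap) (simp add: sum_distrib_left)
  also have "\<dots> = (\<Sum>f\<in>?E. ?m N f)"
    by (simp add: sum_pmf_eq_1)
  finally show ?case using Suc.IH by simp
qed

section \<open>Bounding the expected ratio\<close>

lemma (in prob_space) expectation_finite_range:
  fixes g :: "'b \<Rightarrow> real"
  assumes A: "finite A" "\<And>\<omega>. \<omega> \<in> space M \<Longrightarrow> V \<omega> \<in> A"
    and meas: "\<And>v. v \<in> A \<Longrightarrow> {\<omega> \<in> space M. V \<omega> = v} \<in> events"
  shows "expectation (\<lambda>\<omega>. g (V \<omega>)) = (\<Sum>v\<in>A. prob {\<omega> \<in> space M. V \<omega> = v} * g v)"
proof -
  let ?S = "\<lambda>v. {\<omega> \<in> space M. V \<omega> = v}"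
  have "expectation (\<lambda>\<omega>. g (V \<omega>)) = expectation (\<lambda>\<omega>. \<Sum>v\<in>A. indicator (?S v) \<omega> * g v)"
  proof (rule Bochner_Integration.integral_cong[OF refl])
    fix \<omega> assume \<omega>: "\<omega> \<in> space M"
    have "(\<Sum>v\<in>A. indicator (?S v) \<omega> * g v) = (\<Sum>v\<in>A. if v = V \<omega> then g v else 0)"
      using \<omega> by (intro sum.cong) auto
    then show "g (V \<omega>) = (\<Sum>v\<in>A. indicator (?S v) \<omega> * g v)"
      using A \<omega> by simp
  qed
  also have "\<dots> = (\<Sum>v\<in>A. expectation (\<lambda>\<omega>. indicator (?S v) \<omega> * g v))"
    by (intro Bochner_Integration.integral_sum integrable_mult_left integrable_real_indicator meas)
      (simp_all add: emeasure_eq_measure)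
  also have "\<dots> = (\<Sum>v\<in>A. prob (?S v) * g v)"
    by (intro sum.cong refl) (simp add: sets.Int_space_eq2[OF meas])
  finally show ?thesis .
qed

text \<open>
  The average of the ratios, weighted by the shares of the numerator, dominates the ratio of the
  sums. Convexity of \<open>1 / t\<close> enters through its tangent line at \<open>t = F / p\<close>: with \<open>s = p / F\<close>
  each ratio satisfies \<open>p z / f z \<ge> 2 * s - s\<^sup>2 * (f z / p z)\<close>, and the weighted average of the
  right-hand sides is \<open>s\<close>.
\<close>

lemma ratio_of_sums_le:
  fixes p f :: "'z \<Rightarrow> real"
  assumes "finite I" "I \<noteq> {}" and pos: "\<And>z. z \<in> I \<Longrightarrow> p z > 0" "\<And>z. z \<in> I \<Longrightarrow> f z > 0"
  shows "sum p I / sum f I \<le> (\<Sum>z\<in>I. p z / sum p I * (p z / f z))"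
proof -
  define s where "s = sum p I / sum f I"
  have P: "sum p I > 0" and F: "sum f I > 0"
    using assms by (auto intro!: sum_pos)
  have tangent: "2 * s * p z - s\<^sup>2 * f z \<le> p z * (p z / f z)" if "z \<in> I" for z
  proof -
    have "0 \<le> (p z - s * f z)\<^sup>2 / f z"
      using pos(2)[OF that] by simp
    also have "\<dots> = p z * (p z / f z) - (2 * s * p z - s\<^sup>2 * f z)"
      using pos(2)[OF that] by (simp add: field_simps power2_eq_square)
    finally show ?thesis by simp
  qed
  have "s * sum p I = 2 * s * sum p I - s\<^sup>2 * sum f I"
    using F by (simp add: s_def power2_eq_square)
  also have "\<dots> = (\<Sum>z\<in>I. 2 * s * p z - s\<^sup>2 * f z)"
    by (simp add: sum_subtractf sum_distrib_left)
  also have "\<dots> \<le> (\<Sum>z\<in>I. p z * (p z / f z))"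
    by (rule sum_mono) (rule tangent)
  finally have "s \<le> (\<Sum>z\<in>I. p z * (p z / f z)) / sum p I"
    using P by (simp add: pos_le_divide_eq)
  then show ?thesis
    by (simp add: s_def sum_divide_distrib mult.commute)
qed

text \<open>
  The heart of the argument: the variables are summed out in the order \<open>ys\<close>, \<open>xs\<close>, \<open>zs\<close>. The sum
  over \<open>ys\<close> can come first because neither the kernels \<open>k\<close> nor the first factor involve \<open>ys\<close>.
\<close>

lemma oblivious_expected_ratio_le_1:
  fixes q :: "'z::finite pmf" and r :: "'x::finite \<Rightarrow> 'z \<Rightarrow> 'y::finite pmf"
  shows "(\<Sum>zs\<in>{1..N} \<rightarrow>\<^sub>E UNIV. \<Sum>xs\<in>{1..N} \<rightarrow>\<^sub>E UNIV. \<Sum>ys\<in>{1..N} \<rightarrow>\<^sub>E UNIV.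
            oblivious_mass N q k r xs ys zs *
            ((real N + 1) * pmf q z / (real (card {n\<in>{1..N}. zs n = z}) + 1) *
             ((real (card {n\<in>{1..N}. (xs n, zs n) = (x, z)}) + 1) * pmf (r x z) y /
              (real (card {n\<in>{1..N}. (xs n, ys n, zs n) = (x, y, z)}) + 1)))) \<le> 1"
    (is "(\<Sum>zs\<in>?EZ. \<Sum>xs\<in>?EX. \<Sum>ys\<in>?EY. _ * (?a zs * ?b xs ys zs)) \<le> 1")
proof -
  let ?Q = "\<lambda>zs. \<Prod>n\<in>{1..N}. pmf q (zs n)"
  let ?K = "\<lambda>xs zs. \<Prod>n\<in>{1..N}. pmf (k n (map xs [1..<n]) (map zs [1..<Suc n])) (xs n)"
  let ?R = "\<lambda>xs ys zs. \<Prod>n\<in>{1..N}. pmf (r (xs n) (zs n)) (ys n)"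
  have Y: "(\<Sum>ys\<in>?EY. ?R xs ys zs * ?b xs ys zs) \<le> 1" for xs zs
  proof -
    let ?S = "{n\<in>{1..N}. (xs n, zs n) = (x, z)}"
    have eq: "{n\<in>{1..N}. (xs n, ys n, zs n) = (x, y, z)} = {n\<in>?S. ys n = y}" for ys
      by auto
    show ?thesis
      unfolding eq by (rule sum_add_one_count_le_1) (auto simp: pmf_le_1)
  qed
  have X: "(\<Sum>xs\<in>?EX. ?K xs zs) = 1" for zs
    by (rule sum_prod_adapted_kernels) (auto intro!: arg_cong2[of _ _ _ _ "k _"])
  have Z: "(\<Sum>zs\<in>?EZ. ?Q zs * ?a zs) \<le> 1"
    using sum_add_one_count_le_1[of "{1..N}" "{1..N}" "pmf q z" "\<lambda>_. q" z]
    by (simp add: pmf_le_1)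
  have mass: "oblivious_mass N q k r xs ys zs = ?Q zs * ?K xs zs * ?R xs ys zs" for xs ys zs
    by (simp only: oblivious_mass_def prod.distrib)
  have regroup: "u * v * w * (a * b) = u * a * (v * (w * b))" for u v w a b :: real
    by simp
  have "(\<Sum>zs\<in>?EZ. \<Sum>xs\<in>?EX. \<Sum>ys\<in>?EY.
           oblivious_mass N q k r xs ys zs * (?a zs * ?b xs ys zs))
      = (\<Sum>zs\<in>?EZ. ?Q zs * ?a zs * (\<Sum>xs\<in>?EX. ?K xs zs * (\<Sum>ys\<in>?EY. ?R xs ys zs * ?b xs ys zs)))"
    by (simp only: mass regroup sum_distrib_left[symmetric])
  also have "\<dots> \<le> (\<Sum>zs\<in>?EZ. ?Q zs * ?a zs * (\<Sum>xs\<in>?EX. ?K xs zs * 1))"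
    by (intro sum_mono mult_left_mono Y mult_nonneg_nonneg prod_nonneg divide_nonneg_nonneg) auto
  also have "\<dots> \<le> 1"
    using X Z by simp
  finally show ?thesis .
qed

lemma restrict_eq_PiE_iff:
  "g \<in> A \<rightarrow>\<^sub>E B \<Longrightarrow> restrict f A = g \<longleftrightarrow> (\<forall>n\<in>A. f n = g n)"
  by (auto simp: fun_eq_iff PiE_def extensional_def)

lemma F_do_restrict:
  "F_do N (restrict xs {1..N}) (restrict ys {1..N}) (restrict zs {1..N}) x y = F_do N xs ys zs x y"
  unfolding F_do_def by (simp cong: conj_cong)

theorem lemma3:
  fixes N :: nat
    and q :: "'z::finite pmf"
    and r :: "'x::finite \<Rightarrow> 'z \<Rightarrow> 'y::finite pmf"
    and k :: "nat \<Rightarrow> 'x list \<Rightarrow> 'z list \<Rightarrow> 'x pmf"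
    and M :: "'w measure"
    and X :: "nat \<Rightarrow> 'w \<Rightarrow> 'x" and Y :: "nat \<Rightarrow> 'w \<Rightarrow> 'y" and Z :: "nat \<Rightarrow> 'w \<Rightarrow> 'z"
    and x :: 'x and y :: 'y
  assumes "N \<ge> 1"
    and "\<And>z. pmf q z > 0"
    and "\<And>x' z y'. pmf (r x' z) y' > 0"
    and "prob_space M"
    and "\<And>n. n \<in> {1..N} \<Longrightarrow> X n \<in> measurable M (count_space UNIV)"
    and "\<And>n. n \<in> {1..N} \<Longrightarrow> Y n \<in> measurable M (count_space UNIV)"
    and "\<And>n. n \<in> {1..N} \<Longrightarrow> Z n \<in> measurable M (count_space UNIV)"
    and "\<And>xs ys zs. measure M {\<omega> \<in> space M. \<forall>n\<in>{1..N}. (X n \<omega>, Y n \<omega>, Z n \<omega>) = (xs n, ys n, zs n)}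
           = oblivious_mass N q k r xs ys zs"
  shows "prob_space.expectation M
           (\<lambda>\<omega>. p_do q r x y / F_do N (\<lambda>n. X n \<omega>) (\<lambda>n. Y n \<omega>) (\<lambda>n. Z n \<omega>) x y) \<le> 1"
proof -
  interpret prob_space M by fact
  let ?I = "{1..N}"
  let ?EX = "?I \<rightarrow>\<^sub>E (UNIV :: 'x set)"
  let ?EY = "?I \<rightarrow>\<^sub>E (UNIV :: 'y set)"
  let ?EZ = "?I \<rightarrow>\<^sub>E (UNIV :: 'z set)"
  let ?p = "p_do q r x y"
  let ?pz = "\<lambda>z. pmf q z * pmf (r x z) y"
  let ?T = "\<lambda>z xs ys zs. (real N + 1) * pmf q z / (real (card {n\<in>?I. zs n = z}) + 1) *
             ((real (card {n\<in>?I. (xs n, zs n) = (x, z)}) + 1) * pmf (r x z) y /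
              (real (card {n\<in>?I. (xs n, ys n, zs n) = (x, y, z)}) + 1))"
  have pz_pos: "?pz z > 0" for z
    using assms(2)[of z] assms(3)[of x z y] by simp
  have p_pos: "?p > 0"
    unfolding p_do_def by (rule sum_pos) (use pz_pos in auto)
  have quot: "u * v / (a / m * (c / b)) = m * u / a * (b * v / c)" for u v a m c b :: real
    by simp
  have pointwise: "?p / F_do N xs ys zs x y \<le> (\<Sum>z\<in>UNIV. ?pz z / ?p * ?T z xs ys zs)" for xs ys zs
  proof -
    let ?f = "\<lambda>z. (real (card {n\<in>?I. zs n = z}) + 1) / (real N + 1) *
        ((real (card {n\<in>?I. (xs n, ys n, zs n) = (x, y, z)}) + 1) /
         (real (card {n\<in>?I. (xs n, zs n) = (x, z)}) + 1))"
    have "?p / F_do N xs ys zs x y \<le> (\<Sum>z\<in>UNIV. ?pz z / ?p * (?pz z / ?f z))"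
      unfolding p_do_def F_do_def
      by (rule ratio_of_sums_le)
        (use pz_pos in \<open>auto intro!: mult_pos_pos divide_pos_pos add_nonneg_pos\<close>)
    also have "(\<lambda>z. ?pz z / ?f z) = (\<lambda>z. ?T z xs ys zs)"
      by (rule ext) (rule quot)
    finally show ?thesis .
  qed
  \<comment> \<open>Only finitely many histories up to time \<open>N\<close> are possible, so the expectation is a finite sum
    over them. Restricting to \<open>{1..N}\<close> makes a history a single value in a finite set.\<close>
  define V where "V = (\<lambda>\<omega>. (restrict (\<lambda>n. Z n \<omega>) ?I, restrict (\<lambda>n. X n \<omega>) ?I, restrict (\<lambda>n. Y n \<omega>) ?I))"
  have V_eq: "{\<omega> \<in> space M. V \<omega> = (zs, xs, ys)}
      = {\<omega> \<in> space M. \<forall>n\<in>?I. (X n \<omega>, Y n \<omega>, Z n \<omega>) = (xs n, ys n, zs n)}"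
    if "zs \<in> ?EZ" "xs \<in> ?EX" "ys \<in> ?EY" for xs ys zs
    using that by (auto simp: V_def restrict_eq_PiE_iff simp del: One_nat_def)
  have "expectation (\<lambda>\<omega>. ?p / F_do N (\<lambda>n. X n \<omega>) (\<lambda>n. Y n \<omega>) (\<lambda>n. Z n \<omega>) x y)
      = expectation (\<lambda>\<omega>. case V \<omega> of (zs, xs, ys) \<Rightarrow> ?p / F_do N xs ys zs x y)"
    by (simp only: V_def F_do_restrict prod.case)
  also have "\<dots> = (\<Sum>v\<in>?EZ \<times> ?EX \<times> ?EY. prob {\<omega> \<in> space M. V \<omega> = v} *
                    (case v of (zs, xs, ys) \<Rightarrow> ?p / F_do N xs ys zs x y))"
  proof (rule expectation_finite_range)
    show "finite (?EZ \<times> ?EX \<times> ?EY)"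
      by (intro finite_cartesian_product finite_PiE) auto
    show "V \<omega> \<in> ?EZ \<times> ?EX \<times> ?EY" for \<omega>
      by (auto simp: V_def)
    show "{\<omega> \<in> space M. V \<omega> = v} \<in> events" if v: "v \<in> ?EZ \<times> ?EX \<times> ?EY" for v
    proof -
      obtain zs xs ys where [simp]: "v = (zs, xs, ys)" by (cases v)
      have [measurable]: "Measurable.pred M (\<lambda>\<omega>. X n \<omega> = xs n)" "Measurable.pred M (\<lambda>\<omega>. Y n \<omega> = ys n)"
          "Measurable.pred M (\<lambda>\<omega>. Z n \<omega> = zs n)" if "n \<in> ?I" for n
        using assms(5-7)[OF that] by measurable
      have "{\<omega> \<in> space M. \<forall>n\<in>?I. X n \<omega> = xs n \<and> Y n \<omega> = ys n \<and> Z n \<omega> = zs n} \<in> events"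
        by measurable
      with v show ?thesis by (simp add: V_eq)
    qed
  qed
  also have "\<dots> = (\<Sum>zs\<in>?EZ. \<Sum>xs\<in>?EX. \<Sum>ys\<in>?EY.
                    oblivious_mass N q k r xs ys zs * (?p / F_do N xs ys zs x y))"
    unfolding sum.cartesian_product by (intro sum.cong refl) (auto simp: V_eq assms(8)[symmetric])
  also have "\<dots> \<le> (\<Sum>zs\<in>?EZ. \<Sum>xs\<in>?EX. \<Sum>ys\<in>?EY.
                    oblivious_mass N q k r xs ys zs * (\<Sum>z\<in>UNIV. ?pz z / ?p * ?T z xs ys zs))"
    by (intro sum_mono mult_left_mono pointwise) (simp add: assms(8)[symmetric])
  also have "\<dots> = (\<Sum>z\<in>UNIV. ?pz z / ?p * (\<Sum>zs\<in>?EZ. \<Sum>xs\<in>?EX. \<Sum>ys\<in>?EY.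
                    oblivious_mass N q k r xs ys zs * ?T z xs ys zs))"
    unfolding sum_distrib_left
    by (simp only: sum.swap[where B = UNIV] mult.left_commute)
  also have "\<dots> \<le> (\<Sum>z\<in>UNIV. ?pz z / ?p * 1)"
    using p_pos pz_pos
    by (intro sum_mono mult_left_mono oblivious_expected_ratio_le_1) (auto intro: less_imp_le)
  also have "\<dots> = 1"
    using p_pos by (simp add: sum_divide_distrib[symmetric] p_do_def[symmetric])
  finally show ?thesis .
qed

end
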